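(* Let $p$ be a prime and $n\geq 1$ an integer, and let $G=\mathbb{Z}_p^n\rtimes \mathbb{Z}_{p^n-1}$ be the Frobenius group with Frobenius kernel $\mathbb{Z}_p^n$ and Frobenius complement $\mathbb{Z}_{p^n-1}$. Let $C_0=\{e\},C_1,\dots,C_{p^n-1}$ be the conjugacy classes of $G$. For $1\le i\le p^n-1$ let $B_i$ be the $|G|\times|G|$ matrix indexed by $G$ which is $0$ outside the $C_i,C_i$ block and whose $C_i,C_i$ block is $$\frac{-1}{|C_i|-1}J_{|C_i|}+\left(1-\frac{-1}{|C_i|-1}\right)I_{|C_i|},$$ where $J_{m}$ is the $m\times m$ all-ones matrix and $I_m$ is the $m\times m$ identity matrix. Then for each $1\leq i\leq p^n-1$, $\frac{|C_i|-1}{|C_i|}B_i$ is a non-primary primitive idempotent of $T(G)$.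
   Context: Let $G$ be a finite group with identity $e$ and conjugacy classes $C_0=\{e\},C_1,\dots,C_d$. The group association scheme of $G$ has adjacency matrices $A_0,\dots,A_d$, the $|G|\times|G|$ complex matrices indexed by $G$ with $(A_i)_{xy}=1$ if $yx^{-1}\in C_i$ and $0$ otherwise. For $0\le i\le d$ let $E_i^*$ be the diagonal matrix indexed by $G$ with $(E_i^* )_{yy}=1$ if $y\in C_i$ and $0$ otherwise. The Terwilliger algebra $T(G)$ (base point the identity) is the subalgebra of $M_{|G|}(\mathbb{C})$ generated by $A_0,\dots,A_d,E_0^*,\dots,E_d^*$; it is semisimple. The $C_i,C_j$ block of a matrix indexed by $G$ consists of the entries $(a,b)$ with $a\in C_i$, $b\in C_j$. The primary component $V$ of $T(G)$ is the irreducible two-sided ideal of dimension $(d+1)^2$ with basis $\{v_{ij}: 0\le i,j\le d\}$, where $v_{ij}$ has all entries $1$ in the $C_i,C_j$ block and $0$ elsewhere. The primitive idempotents of $T(G)$ here are the idempotents corresponding to its Wedderburn components, i.e. the identity elements of the irreducible (minimal) two-sided ideals of $T(G)$; such an idempotent is non-primary if its ideal is not $V$. That $G$ is a Frobenius group entails that the complement is nontrivial, so $p^n\neq 2$ and $|C_i|\ge 2$ for $i\ge 1$. *)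

theory Defs
  imports
    "HOL-Algebra.Group_Action"
    "HOL-Algebra.Product_Groups"
    "HOL-Algebra.Subrings"
    "HOL-Algebra.Ideal"
    "HOL-Computational_Algebra.Primes"
    "Jordan_Normal_Form.Matrix"
begin

section \<open>Frobenius groups\<close>

definition conj_classes :: "('a, 'b) monoid_scheme \<Rightarrow> 'a set set" where
  "conj_classes G =
     orbits G (carrier G) (\<lambda>g. \<lambda>x \<in> carrier G. g \<otimes>\<^bsub>G\<^esub> x \<otimes>\<^bsub>G\<^esub> inv\<^bsub>G\<^esub> g)"

definition conj_subgroup :: "('a, 'b) monoid_scheme \<Rightarrow> 'a \<Rightarrow> 'a set \<Rightarrow> 'a set" where
  "conj_subgroup G g H = (g <#\<^bsub>G\<^esub> H) #>\<^bsub>G\<^esub> inv\<^bsub>G\<^esub> g"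

definition semidirect_product_of :: "('a, 'b) monoid_scheme \<Rightarrow> 'a set \<Rightarrow> 'a set \<Rightarrow> bool" where
  "semidirect_product_of G K H \<longleftrightarrow>
     K \<lhd> G \<and> subgroup H G \<and> K <#>\<^bsub>G\<^esub> H = carrier G \<and> K \<inter> H = {\<one>\<^bsub>G\<^esub>}"

definition frobenius_complement :: "('a, 'b) monoid_scheme \<Rightarrow> 'a set \<Rightarrow> bool" where
  "frobenius_complement G H \<longleftrightarrow>
     subgroup H G \<and> H \<noteq> {\<one>\<^bsub>G\<^esub>} \<and> H \<noteq> carrier G \<and>
     (\<forall>g \<in> carrier G - H. H \<inter> conj_subgroup G g H = {\<one>\<^bsub>G\<^esub>})"

definition frobenius_kernel :: "('a, 'b) monoid_scheme \<Rightarrow> 'a set \<Rightarrow> 'a set" where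
  "frobenius_kernel G H =
     insert \<one>\<^bsub>G\<^esub> (carrier G - (\<Union>g \<in> carrier G. conj_subgroup G g H))"


section \<open>Matrices indexed by a finite group\<close>

text \<open>A matrix indexed by \<open>G\<close> is represented as an ordinary square matrix of size \<open>order G\<close>
  by means of an enumeration \<open>\<nu>\<close> of the elements of \<open>G\<close>, that is, a bijection from
  \<open>{..<order G}\<close> onto \<open>carrier G\<close>: its entry in position \<open>(k, l)\<close> is the one
  belonging to the pair of group elements \<open>(\<nu> k, \<nu> l)\<close>.\<close>

definition group_mat ::
  "('a, 'b) monoid_scheme \<Rightarrow> (nat \<Rightarrow> 'a) \<Rightarrow> ('a \<Rightarrow> 'a \<Rightarrow> complex) \<Rightarrow> complex mat" where
  "group_mat G \<nu> f = mat (order G) (order G) (\<lambda>(k, l). f (\<nu> k) (\<nu> l))"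

definition adjacency_mat ::
  "('a, 'b) monoid_scheme \<Rightarrow> (nat \<Rightarrow> 'a) \<Rightarrow> 'a set \<Rightarrow> complex mat" where
  "adjacency_mat G \<nu> C = group_mat G \<nu> (\<lambda>x y. if y \<otimes>\<^bsub>G\<^esub> inv\<^bsub>G\<^esub> x \<in> C then 1 else 0)"

definition dual_idempotent_mat ::
  "('a, 'b) monoid_scheme \<Rightarrow> (nat \<Rightarrow> 'a) \<Rightarrow> 'a set \<Rightarrow> complex mat" where
  "dual_idempotent_mat G \<nu> C = group_mat G \<nu> (\<lambda>x y. if x = y \<and> y \<in> C then 1 else 0)"


section \<open>The Terwilliger algebra\<close>

definition mat_subalgebra :: "nat \<Rightarrow> complex mat set \<Rightarrow> bool" where
  "mat_subalgebra N S \<longleftrightarrow>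
     subring S (ring_mat TYPE(complex) N ()) \<and> (\<forall>c. \<forall>M \<in> S. c \<cdot>\<^sub>m M \<in> S)"

definition generated_mat_subalgebra :: "nat \<Rightarrow> complex mat set \<Rightarrow> complex mat set" where
  "generated_mat_subalgebra N X = \<Inter> {S. mat_subalgebra N S \<and> X \<subseteq> S}"

text \<open>Subrings contain the identity matrix. This does not enlarge the generated algebra,
  because the dual idempotents sum to the identity matrix.\<close>

definition terwilliger_algebra ::
  "('a, 'b) monoid_scheme \<Rightarrow> (nat \<Rightarrow> 'a) \<Rightarrow> complex mat ring" where
  "terwilliger_algebra G \<nu> =
     (ring_mat TYPE(complex) (order G) ())
       \<lparr> carrier := generated_mat_subalgebra (order G)
           (adjacency_mat G \<nu> ` conj_classes G \<union> dual_idempotent_mat G \<nu> ` conj_classes G) \<rparr>"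

text \<open>The linear span of the matrices \<open>v\<^sub>C\<^sub>D\<close>, written entrywise; \<open>v\<^sub>C\<^sub>D\<close> is all ones
  on the \<open>C, D\<close> block and zero elsewhere.\<close>

definition primary_component ::
  "('a, 'b) monoid_scheme \<Rightarrow> (nat \<Rightarrow> 'a) \<Rightarrow> complex mat set" where
  "primary_component G \<nu> =
     {group_mat G \<nu> (\<lambda>x y. \<Sum>C \<in> conj_classes G. \<Sum>D \<in> conj_classes G.
        a C D * (if x \<in> C \<and> y \<in> D then 1 else 0)) | a. True}"


section \<open>Primitive idempotents\<close>

definition minimal_ideal :: "'r set \<Rightarrow> ('r, 'm) ring_scheme \<Rightarrow> bool" where
  "minimal_ideal I R \<longleftrightarrow>
     ideal I R \<and> I \<noteq> {\<zero>\<^bsub>R\<^esub>} \<and> (\<forall>J. ideal J R \<longrightarrow> J \<subseteq> I \<longrightarrow> J = {\<zero>\<^bsub>R\<^esub>} \<or> J = I)"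

definition identity_of_ideal :: "('r, 'm) ring_scheme \<Rightarrow> 'r set \<Rightarrow> 'r \<Rightarrow> bool" where
  "identity_of_ideal R I u \<longleftrightarrow> u \<in> I \<and> (\<forall>x \<in> I. u \<otimes>\<^bsub>R\<^esub> x = x \<and> x \<otimes>\<^bsub>R\<^esub> u = x)"

text \<open>These are the identities of the Wedderburn components, i.e. the primitive elements among
  the central idempotents of \<open>T(G)\<close>.\<close>

definition nonprimary_primitive_idempotent ::
  "('a, 'b) monoid_scheme \<Rightarrow> (nat \<Rightarrow> 'a) \<Rightarrow> complex mat \<Rightarrow> bool" where
  "nonprimary_primitive_idempotent G \<nu> M \<longleftrightarrow>
     (\<exists>I. minimal_ideal I (terwilliger_algebra G \<nu>) \<and>
          identity_of_ideal (terwilliger_algebra G \<nu>) I M \<and>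
          I \<noteq> primary_component G \<nu>)"

definition B_mat ::
  "('a, 'b) monoid_scheme \<Rightarrow> (nat \<Rightarrow> 'a) \<Rightarrow> 'a set \<Rightarrow> complex mat" where
  "B_mat G \<nu> C = group_mat G \<nu> (\<lambda>x y.
     if x \<in> C \<and> y \<in> C
     then (-1) / (of_nat (card C) - 1) * 1
          + (1 - (-1) / (of_nat (card C) - 1)) * (if x = y then 1 else 0)
     else 0)"

end

theory Submission
  imports Defs
begin

text \<open>Write \<open>M\<^sub>C = I\<^sub>C - J\<^sub>C / |C|\<close>, supported on the \<open>C, C\<close> block; for \<open>|C| \<ge> 2\<close> this is the
  rescaled matrix of the theorem (\<open>B_mat_eq_centering\<close>). It is the orthogonal projection onto the
  functions on \<open>C\<close> of sum zero, hence idempotent. The point is that the line \<open>\<complex> M\<^sub>C\<close> is already a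
  two-sided ideal of the Terwilliger algebra. A nonzero ideal inside a line is the whole
  line, so the line is minimal, with identity element \<open>M\<^sub>C\<close> (\<open>minimal_ideal_line\<close>,
  \<open>identity_of_ideal_line\<close>).

  For the ideal property, consider the matrices \<open>X\<close> for which \<open>X M\<^sub>C = M\<^sub>C X\<close> is a multiple of \<open>M\<^sub>C\<close>.
  They form a subalgebra (\<open>mat_subalgebra_common_eigenmatrix\<close>), so it is enough to find the
  generators among them. Suppose that every row of \<open>X\<close> with index outside \<open>C\<close> is constant on \<open>C\<close>,
  likewise every column with index outside \<open>C\<close>, and that the \<open>C, C\<close> block of \<open>X\<close> is
  \<open>\<alpha> J + (\<beta> - \<alpha>) I\<close>. As \<open>M\<^sub>C\<close> annihilates constants, then \<open>X M\<^sub>C = M\<^sub>C X = (\<beta> - \<alpha>) M\<^sub>C\<close>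
  (\<open>group_mat_centering_eigen\<close>).

  That the adjacency matrices have this shape is where the group enters. Let \<open>K\<close> be the Frobenius
  kernel and \<open>H\<close> the complement. Since \<open>H\<close> is abelian, conjugate elements lie in the same coset of
  \<open>K\<close>. Conversely, conjugation by \<open>H\<close> is free on \<open>K - {1}\<close>, and conjugation by \<open>K\<close> is free
  outside \<open>K\<close>. As \<open>|K| = |H| + 1\<close>, counting makes both actions transitive, the latter
  on each coset of \<open>K\<close> other than \<open>K\<close> itself. Hence the conjugacy classes are \<open>{1}\<close>, \<open>K - {1}\<close> and
  the cosets other than \<open>K\<close>; equivalently, two elements are conjugate iff they agree modulo \<open>K\<close> and
  are both equal to \<open>1\<close> or both different from \<open>1\<close> (\<open>conjugate_iff\<close>). So the class of
  \<open>y x\<^sup>-\<^sup>1\<close> depends only on the classes of \<open>x\<close> and \<open>y\<close> and on whether \<open>x = y\<close>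
  (\<open>conj_class_div_cong\<close>).

  Finally, \<open>M\<^sub>C\<close> lies in the algebra since \<open>J\<^sub>C - I\<^sub>C\<close> is the \<open>C, C\<close> block of the adjacency matrix
  of \<open>K - {1}\<close>, and it lies outside the primary component since its diagonal and off-diagonal entries
  on the \<open>C, C\<close> block differ.\<close>

section \<open>Conjugacy classes of a sharp Frobenius group\<close>

context group
begin

lemma cancel_inv:
  assumes "x \<in> carrier G" "y \<in> carrier G"
  shows "inv x \<otimes> (x \<otimes> y) = y" "x \<otimes> (inv x \<otimes> y) = y"
  using assms by (simp_all flip: m_assoc)

lemma mult_inv_eq_one_iff:
  assumes "x \<in> carrier G" "y \<in> carrier G"
  shows "x \<otimes> inv y = \<one> \<longleftrightarrow> x = y"
  using assms by (subst inv_solve_right') auto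

lemma conj_eq_one_iff:
  assumes "x \<in> carrier G" "y \<in> carrier G"
  shows "x \<otimes> y \<otimes> inv x = \<one> \<longleftrightarrow> y = \<one>"
  using assms mult_inv_eq_one_iff[of "x \<otimes> y" x] by simp

end

text \<open>By conjugation \<open>H\<close> acts freely on \<open>K - {1}\<close>, so that \<open>|H| \<le> |K| - 1\<close>; equality means that the
  action is sharply transitive.\<close>

locale sharp_frobenius_group = group G for G (structure) +
  fixes K H :: "'a set"
  assumes finite_carrier: "finite (carrier G)"
    and semidirect: "semidirect_product_of G K H"
    and complement: "frobenius_complement G H"
    and kernel: "K = frobenius_kernel G H"
    and commutative_complement: "\<lbrakk>x \<in> H; y \<in> H\<rbrakk> \<Longrightarrow> x \<otimes> y = y \<otimes> x"
    and card_kernel: "card K = Suc (card H)"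
begin

sublocale K: normal K G
  using semidirect by (simp add: semidirect_product_of_def)

lemma complement_subgroup: "subgroup H G"
  and kernel_Int_complement: "K \<inter> H = {\<one>}"
  and kernel_mult_complement: "K <#> H = carrier G"
  using semidirect by (simp_all add: semidirect_product_of_def)

lemma finite_kernel: "finite K"
  using K.subset finite_carrier finite_subset by blast

lemma finite_complement: "finite H"
  using subgroup.subset[OF complement_subgroup] finite_carrier finite_subset by blast

text \<open>An element \<open>t\<close> of \<open>H\<close> that commutes with \<open>a\<close> lies in \<open>H\<close> and in \<open>a H a\<^sup>-\<^sup>1\<close>, and
  these intersect trivially because \<open>a\<close> is outside \<open>H\<close>.\<close>

lemma complement_fixed_point_free:
  assumes t: "t \<in> H" and a: "a \<in> K" "a \<noteq> \<one>" and comm: "t \<otimes> a = a \<otimes> t"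
  shows "t = \<one>"
proof -
  have tc: "t \<in> carrier G" using t complement_subgroup by (rule subgroup.mem_carrier[rotated])
  have ac: "a \<in> carrier G" using a by (simp add: K.mem_carrier)
  have "a \<notin> H" using a kernel_Int_complement by blast
  moreover have "t \<in> conj_subgroup G a H"
  proof -
    have "t = a \<otimes> t \<otimes> inv a"
      using comm tc ac by (simp add: m_assoc cancel_inv flip: comm)
    then show ?thesis using t unfolding conj_subgroup_def l_coset_def r_coset_def by blast
  qed
  ultimately show ?thesis
    using complement t ac unfolding frobenius_complement_def by blast
qed

text \<open>Every element outside the kernel is conjugate into \<open>H\<close>; transporting \<open>k\<close> by the same conjugation
  keeps it in the normal subgroup \<open>K\<close>. If \<open>k \<noteq> 1\<close>, the previous lemma then makes the element of \<open>H\<close>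
  trivial, whereas \<open>a \<noteq> 1\<close>.\<close>

lemma kernel_fixed_point_free:
  assumes k: "k \<in> K" and a: "a \<in> carrier G" "a \<notin> K" and comm: "k \<otimes> a = a \<otimes> k"
  shows "k = \<one>"
proof (rule ccontr)
  assume k1: "k \<noteq> \<one>"
  have "a \<in> (\<Union>g \<in> carrier G. conj_subgroup G g H)"
    using a unfolding kernel frobenius_kernel_def by blast
  then obtain g t where g: "g \<in> carrier G" and t: "t \<in> H" and at: "a = g \<otimes> t \<otimes> inv g"
    by (auto simp: conj_subgroup_def l_coset_def r_coset_def)
  have tc: "t \<in> carrier G" using t complement_subgroup by (rule subgroup.mem_carrier[rotated])
  have kc: "k \<in> carrier G" using k by (rule K.mem_carrier)
  define k' where "k' = inv g \<otimes> k \<otimes> g"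
  have k': "k' \<in> K" unfolding k'_def using K.inv_op_closed1[OF g k] .
  have kk': "k = g \<otimes> k' \<otimes> inv g"
    unfolding k'_def using g kc by (simp add: m_assoc cancel_inv)
  have k'c: "k' \<in> carrier G" using k' by (rule K.mem_carrier)
  have "k' \<noteq> \<one>" using k1 kk' g by auto
  moreover have "t \<otimes> k' = k' \<otimes> t"
  proof -
    have "g \<otimes> (k' \<otimes> t) \<otimes> inv g = k \<otimes> a"
      unfolding kk' at using g tc k'c by (simp add: m_assoc cancel_inv)
    moreover have "g \<otimes> (t \<otimes> k') \<otimes> inv g = a \<otimes> k"
      unfolding kk' at using g tc k'c by (simp add: m_assoc cancel_inv)
    ultimately have "g \<otimes> (t \<otimes> k') \<otimes> inv g = g \<otimes> (k' \<otimes> t) \<otimes> inv g" using comm by simp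
    then show ?thesis using g tc k'c by simp
  qed
  ultimately have "t = \<one>" using complement_fixed_point_free t k' by blast
  then have "a = \<one>" using at g by simp
  then show False using a K.one_closed by simp
qed

lemma mem_coset_iff:
  assumes "x \<in> carrier G" "y \<in> carrier G"
  shows "y \<in> K #> x \<longleftrightarrow> K #> x = K #> y"
  using assms repr_independence[OF _ assms(1) K.is_subgroup] rcos_self[OF assms(2) K.is_subgroup] by auto

text \<open>The quotient by \<open>K\<close> is commutative, since \<open>H\<close> is a commutative set of coset
  representatives.\<close>

lemma coset_mult_commute:
  assumes x: "x \<in> carrier G" and y: "y \<in> carrier G"
  shows "K #> (x \<otimes> y) = K #> (y \<otimes> x)"
proof -
  have rep: "\<exists>h\<in>H. K #> z = K #> h" if "z \<in> carrier G" for z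
  proof -
    from that obtain k h where "k \<in> K" "h \<in> H" "z = k \<otimes> h"
      using kernel_mult_complement unfolding set_mult_def by blast
    then have "z \<in> K #> h" by (auto simp: r_coset_def)
    then show ?thesis
      using \<open>h \<in> H\<close> subgroup.mem_carrier[OF complement_subgroup] repr_independence[OF _ _ K.is_subgroup]
      by blast
  qed
  obtain h h' where h: "h \<in> H" "K #> x = K #> h" and h': "h' \<in> H" "K #> y = K #> h'"
    using rep x y by blast
  have hc: "h \<in> carrier G" "h' \<in> carrier G"
    using h h' subgroup.mem_carrier[OF complement_subgroup] by auto
  have "K #> (x \<otimes> y) = K #> (h \<otimes> h')"
    using x y hc h h' by (simp flip: K.rcos_sum)
  also have "\<dots> = K #> (h' \<otimes> h)"
    using commutative_complement h h' by simp
  also have "\<dots> = K #> (y \<otimes> x)"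
    using x y hc h h' by (simp flip: K.rcos_sum)
  finally show ?thesis .
qed

lemma coset_conj:
  assumes a: "a \<in> carrier G" and g: "g \<in> carrier G"
  shows "K #> (g \<otimes> a \<otimes> inv g) = K #> a"
proof -
  have "K #> (g \<otimes> a \<otimes> inv g) = (K #> (g \<otimes> a)) <#> (K #> inv g)"
    using a g by (simp add: K.rcos_sum)
  also have "\<dots> = (K #> (a \<otimes> g)) <#> (K #> inv g)"
    using a g by (simp add: coset_mult_commute)
  also have "\<dots> = K #> a"
    using a g by (simp add: K.rcos_sum m_assoc)
  finally show ?thesis .
qed

text \<open>The next two lemmas turn the fixed-point-freeness into transitivity: an injective map between
  finite sets of equal size is onto.\<close>

lemma conj_image_kernel:
  assumes a: "a \<in> K" "a \<noteq> \<one>"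
  shows "(\<lambda>h. h \<otimes> a \<otimes> inv h) ` H = K - {\<one>}"
proof (rule card_subset_eq)
  have ac: "a \<in> carrier G" using a by (simp add: K.mem_carrier)
  have Hc: "h \<in> carrier G" if "h \<in> H" for h
    using that by (rule subgroup.mem_carrier[OF complement_subgroup])
  show "finite (K - {\<one>})" using finite_kernel by simp
  show "(\<lambda>h. h \<otimes> a \<otimes> inv h) ` H \<subseteq> K - {\<one>}"
  proof (rule image_subsetI)
    fix h assume h: "h \<in> H"
    have "h \<otimes> a \<otimes> inv h \<in> K" using K.inv_op_closed2 Hc[OF h] a by blast
    moreover have "h \<otimes> a \<otimes> inv h \<noteq> \<one>"
      using Hc[OF h] ac a by (simp add: conj_eq_one_iff)
    ultimately show "h \<otimes> a \<otimes> inv h \<in> K - {\<one>}" by simp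
  qed
  have "inj_on (\<lambda>h. h \<otimes> a \<otimes> inv h) H"
  proof (rule inj_onI)
    fix h h' assume h: "h \<in> H" "h' \<in> H" and eq: "h \<otimes> a \<otimes> inv h = h' \<otimes> a \<otimes> inv h'"
    note hc = Hc[OF h(1)] Hc[OF h(2)]
    define t where "t = inv h' \<otimes> h"
    have t: "t \<in> H" unfolding t_def
      using h complement_subgroup by (simp add: subgroup.m_closed subgroup.m_inv_closed)
    have "t \<otimes> a = inv h' \<otimes> (h \<otimes> a \<otimes> inv h) \<otimes> h"
      unfolding t_def using hc ac by (simp add: m_assoc cancel_inv)
    also have "\<dots> = a \<otimes> t"
      unfolding t_def eq using hc ac by (simp add: m_assoc cancel_inv)
    finally have "t = \<one>" using complement_fixed_point_free t a by blast
    then show "h = h'" unfolding t_def using hc by (subst (asm) inv_solve_left') auto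
  qed
  then show "card ((\<lambda>h. h \<otimes> a \<otimes> inv h) ` H) = card (K - {\<one>})"
    using card_kernel K.one_closed by (simp add: card_image card_Diff_singleton)
qed

lemma conj_image_coset:
  assumes a: "a \<in> carrier G" "a \<notin> K"
  shows "(\<lambda>k. k \<otimes> a \<otimes> inv k) ` K = K #> a"
proof (rule card_subset_eq)
  have cK: "card (K #> a) = card K"
    using card_rcosets_equal[OF rcosetsI[OF K.subset a(1)] K.subset] by simp
  then show "finite (K #> a)"
    using card_kernel cK card_ge_0_finite[of "K #> a"] by simp
  show "(\<lambda>k. k \<otimes> a \<otimes> inv k) ` K \<subseteq> K #> a"
  proof (rule image_subsetI)
    fix k assume "k \<in> K"
    then have k: "k \<in> carrier G" by (rule K.mem_carrier)
    show "k \<otimes> a \<otimes> inv k \<in> K #> a"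
      using coset_conj[OF a(1) k] k a by (simp add: mem_coset_iff)
  qed
  have "inj_on (\<lambda>k. k \<otimes> a \<otimes> inv k) K"
  proof (rule inj_onI)
    fix k k' assume k: "k \<in> K" "k' \<in> K" and eq: "k \<otimes> a \<otimes> inv k = k' \<otimes> a \<otimes> inv k'"
    note kc = K.mem_carrier[OF k(1)] K.mem_carrier[OF k(2)]
    define t where "t = inv k' \<otimes> k"
    have t: "t \<in> K" unfolding t_def using k by simp
    have "t \<otimes> a = inv k' \<otimes> (k \<otimes> a \<otimes> inv k) \<otimes> k"
      unfolding t_def using kc a by (simp add: m_assoc cancel_inv)
    also have "\<dots> = a \<otimes> t"
      unfolding t_def eq using kc a by (simp add: m_assoc cancel_inv)
    finally have "t = \<one>" using kernel_fixed_point_free t a by blast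
    then show "k = k'" unfolding t_def using kc by (subst (asm) inv_solve_left') auto
  qed
  then show "card ((\<lambda>k. k \<otimes> a \<otimes> inv k) ` K) = card (K #> a)"
    using cK by (simp add: card_image)
qed

lemma conjugate_iff:
  assumes a: "a \<in> carrier G" and b: "b \<in> carrier G"
  shows "(\<exists>g \<in> carrier G. b = g \<otimes> a \<otimes> inv g) \<longleftrightarrow> K #> a = K #> b \<and> (a = \<one> \<longleftrightarrow> b = \<one>)"
    (is "?L \<longleftrightarrow> ?R")
proof
  assume ?L
  then obtain g where g: "g \<in> carrier G" and b': "b = g \<otimes> a \<otimes> inv g" by blast
  then show ?R using a by (simp add: coset_conj conj_eq_one_iff)
next
  assume R: ?R
  consider "a = \<one>" | "a \<in> K" "a \<noteq> \<one>" | "a \<notin> K" by blast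
  then show ?L
  proof cases
    case 1
    then show ?thesis using R by (intro bexI[of _ \<one>]) auto
  next
    case 2
    have "b \<in> K #> a" using R a b by (simp add: mem_coset_iff)
    then have "b \<in> K - {\<one>}" using 2 R a by (simp add: coset_join2 K.is_subgroup)
    then have "b \<in> (\<lambda>h. h \<otimes> a \<otimes> inv h) ` H" using conj_image_kernel 2 by simp
    then show ?thesis using subgroup.mem_carrier[OF complement_subgroup] by auto
  next
    case 3
    have "b \<in> K #> a" using R a b by (simp add: mem_coset_iff)
    then have "b \<in> (\<lambda>k. k \<otimes> a \<otimes> inv k) ` K" using conj_image_coset[OF a 3] by simp
    then show ?thesis using K.mem_carrier by auto
  qed
qed

lemma conj_classes_eq:
  "conj_classes G = (\<lambda>a. {b \<in> carrier G. K #> a = K #> b \<and> (a = \<one> \<longleftrightarrow> b = \<one>)}) ` carrier G"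
proof -
  have "orbit G (\<lambda>g. \<lambda>x \<in> carrier G. g \<otimes> x \<otimes> inv g) a
      = {b \<in> carrier G. K #> a = K #> b \<and> (a = \<one> \<longleftrightarrow> b = \<one>)}" if a: "a \<in> carrier G" for a
  proof -
    have "orbit G (\<lambda>g. \<lambda>x \<in> carrier G. g \<otimes> x \<otimes> inv g) a
        = {b \<in> carrier G. \<exists>g\<in>carrier G. b = g \<otimes> a \<otimes> inv g}"
      unfolding orbit_def using a by auto
    also have "\<dots> = {b \<in> carrier G. K #> a = K #> b \<and> (a = \<one> \<longleftrightarrow> b = \<one>)}"
      using conjugate_iff[OF a] by auto
    finally show ?thesis .
  qed
  then show ?thesis
    unfolding conj_classes_def orbits_def Setcompr_eq_image by (rule image_cong[OF refl])
qed

lemma conj_class_subset: "C \<in> conj_classes G \<Longrightarrow> C \<subseteq> carrier G"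
  by (auto simp: conj_classes_eq)

lemma conj_class_coset: "\<lbrakk>C \<in> conj_classes G; x \<in> C; y \<in> C\<rbrakk> \<Longrightarrow> K #> x = K #> y"
  by (auto simp: conj_classes_eq)

lemma conj_class_mem_cong:
  assumes "C \<in> conj_classes G" "x \<in> carrier G" "y \<in> carrier G"
    and "K #> x = K #> y" "x = \<one> \<longleftrightarrow> y = \<one>"
  shows "x \<in> C \<longleftrightarrow> y \<in> C"
  using assms by (auto simp: conj_classes_eq)

lemma conj_classes_disjoint:
  assumes "C \<in> conj_classes G" "D \<in> conj_classes G"
  shows "D = C \<or> D \<inter> C = {}"
  using assms by (auto simp: conj_classes_eq)

lemma coset_div_cong:
  assumes "x \<in> carrier G" "x' \<in> carrier G" "y \<in> carrier G" "y' \<in> carrier G"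
    and "K #> x = K #> x'" "K #> y = K #> y'"
  shows "K #> (y \<otimes> inv x) = K #> (y' \<otimes> inv x')"
proof -
  have "K #> (b \<otimes> inv a) = (K #> b) <#> set_inv (K #> a)"
    if "a \<in> carrier G" "b \<in> carrier G" for a b
    using that by (simp add: K.rcos_sum K.rcos_inv)
  from this[of x y] this[of x' y'] show ?thesis using assms by simp
qed

text \<open>For \<open>x\<close> and \<open>y\<close> in fixed cosets of \<open>K\<close>, the coset of \<open>y x\<^sup>-\<^sup>1\<close> is fixed, and within a coset the
  class is decided by whether the element is \<open>1\<close>, that is, whether \<open>x = y\<close>.\<close>

lemma conj_class_div_cong:
  assumes D: "D \<in> conj_classes G"
    and c: "x \<in> carrier G" "x' \<in> carrier G" "y \<in> carrier G" "y' \<in> carrier G"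
    and eq: "K #> x = K #> x'" "K #> y = K #> y'" "x = y \<longleftrightarrow> x' = y'"
  shows "y \<otimes> inv x \<in> D \<longleftrightarrow> y' \<otimes> inv x' \<in> D"
proof (rule conj_class_mem_cong[OF D])
  show "y \<otimes> inv x = \<one> \<longleftrightarrow> y' \<otimes> inv x' = \<one>"
    using c eq(3) by (auto simp: mult_inv_eq_one_iff)
  show "K #> (y \<otimes> inv x) = K #> (y' \<otimes> inv x')"
    using c eq by (intro coset_div_cong)
qed (use c in simp_all)

lemma kernel_minus_one_conj_class: "K - {\<one>} \<in> conj_classes G"
proof -
  have "card H > 0" using finite_complement complement_subgroup subgroup.one_closed card_gt_0_iff by blast
  then have "card (K - {\<one>}) > 0" using card_kernel K.one_closed by simp
  then have "K - {\<one>} \<noteq> {}" by (metis card.empty less_numeral_extra(3))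
  then obtain a where a: "a \<in> K" "a \<noteq> \<one>" by blast
  have ac: "a \<in> carrier G" using a by (simp add: K.mem_carrier)
  have "K - {\<one>} = {b \<in> carrier G. K #> a = K #> b \<and> (a = \<one> \<longleftrightarrow> b = \<one>)}"
  proof -
    have "b \<in> K \<longleftrightarrow> K #> a = K #> b" if "b \<in> carrier G" for b
      using mem_coset_iff[OF ac that] coset_join2[OF ac K.is_subgroup a(1)] by simp
    then show ?thesis using a K.mem_carrier by blast
  qed
  then show ?thesis unfolding conj_classes_eq using ac by blast
qed

text \<open>A class other than \<open>{1}\<close> contains its whole coset of \<open>K\<close> except possibly \<open>1\<close>, hence at least
  \<open>|K| - 1 = |H| \<ge> 2\<close> elements.\<close>

lemma card_conj_class_ge2:
  assumes C: "C \<in> conj_classes G" "C \<noteq> {\<one>}"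
  shows "card C \<ge> 2"
proof -
  obtain a where a: "a \<in> carrier G"
    and Ca: "C = {b \<in> carrier G. K #> a = K #> b \<and> (a = \<one> \<longleftrightarrow> b = \<one>)}"
    using C by (auto simp: conj_classes_eq)
  have a1: "a \<noteq> \<one>" using C(2) unfolding Ca by auto
  have "(K #> a) - {\<one>} \<subseteq> C"
    unfolding Ca using a a1 mem_coset_iff r_coset_subset_G[OF K.subset a] by auto
  moreover have "finite C" using conj_class_subset[OF C(1)] finite_carrier finite_subset by blast
  ultimately have "card ((K #> a) - {\<one>}) \<le> card C" by (rule card_mono[rotated])
  moreover have "card (K #> a) = Suc (card H)"
    using card_rcosets_equal[OF rcosetsI[OF K.subset a] K.subset] card_kernel by simp
  moreover have "card (K #> a) - 1 \<le> card ((K #> a) - {\<one>})"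
    by (simp add: card_Diff_singleton_if)
  moreover have "card H \<ge> 2"
  proof -
    have "H \<noteq> {\<one>}" "\<one> \<in> H"
      using complement complement_subgroup by (auto simp: frobenius_complement_def subgroup.one_closed)
    then obtain h where "h \<in> H" "h \<noteq> \<one>" by blast
    then have "{\<one>, h} \<subseteq> H" "card {\<one>, h} = 2" using \<open>\<one> \<in> H\<close> by auto
    then show ?thesis using card_mono finite_complement by metis
  qed
  ultimately show ?thesis by linarith
qed

end


section \<open>Lines as minimal ideals of a matrix algebra\<close>

lemma smult_smult_mat: "a \<cdot>\<^sub>m (b \<cdot>\<^sub>m M) = (a * b :: 'a :: semigroup_mult) \<cdot>\<^sub>m M"
  by (rule eq_matI) (auto simp: mult.assoc)

text \<open>Closure under negation comes for free from scalar multiplication by \<open>-1\<close>.\<close>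

lemma mat_subalgebraI:
  assumes S: "S \<subseteq> carrier_mat N N" and one: "1\<^sub>m N \<in> S"
    and mult: "\<And>X Y. \<lbrakk>X \<in> S; Y \<in> S\<rbrakk> \<Longrightarrow> X * Y \<in> S"
    and add: "\<And>X Y. \<lbrakk>X \<in> S; Y \<in> S\<rbrakk> \<Longrightarrow> X + Y \<in> S"
    and smult: "\<And>c X. X \<in> S \<Longrightarrow> c \<cdot>\<^sub>m X \<in> S"
  shows "mat_subalgebra N S"
proof -
  interpret R: ring "ring_mat TYPE(complex) N ()" by (rule ring_mat)
  have neg: "\<ominus>\<^bsub>ring_mat TYPE(complex) N ()\<^esub> X = (-1) \<cdot>\<^sub>m X" if "X \<in> carrier_mat N N" for X
  proof (rule R.minus_equality)
    show "(-1) \<cdot>\<^sub>m X \<oplus>\<^bsub>ring_mat TYPE(complex) N ()\<^esub> X = \<zero>\<^bsub>ring_mat TYPE(complex) N ()\<^esub>"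
      using that by (intro eq_matI) (auto simp: ring_mat_simps)
  qed (use that in \<open>auto simp: ring_mat_simps\<close>)
  have "subring S (ring_mat TYPE(complex) N ())"
  proof (rule R.subringI)
    show "\<ominus>\<^bsub>ring_mat TYPE(complex) N ()\<^esub> X \<in> S" if "X \<in> S" for X
      using that neg smult S by auto
  qed (use assms in \<open>auto simp: ring_mat_simps\<close>)
  then show ?thesis unfolding mat_subalgebra_def using smult by blast
qed

lemma mat_subalgebraD:
  assumes "mat_subalgebra N S"
  shows "S \<subseteq> carrier_mat N N" "1\<^sub>m N \<in> S"
    and "\<And>X Y. \<lbrakk>X \<in> S; Y \<in> S\<rbrakk> \<Longrightarrow> X * Y \<in> S"
    and "\<And>X Y. \<lbrakk>X \<in> S; Y \<in> S\<rbrakk> \<Longrightarrow> X + Y \<in> S"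
    and "\<And>c X. X \<in> S \<Longrightarrow> c \<cdot>\<^sub>m X \<in> S"
  using assms subringE[of S "ring_mat TYPE(complex) N ()"]
  by (auto simp: mat_subalgebra_def ring_mat_simps)

lemma generated_mat_subalgebra_least:
  "\<lbrakk>mat_subalgebra N S; X \<subseteq> S\<rbrakk> \<Longrightarrow> generated_mat_subalgebra N X \<subseteq> S"
  by (auto simp: generated_mat_subalgebra_def)

lemma generated_mat_subalgebra_incl: "X \<subseteq> generated_mat_subalgebra N X"
  by (auto simp: generated_mat_subalgebra_def)

lemma mat_subalgebra_generated:
  assumes "X \<subseteq> carrier_mat N N"
  shows "mat_subalgebra N (generated_mat_subalgebra N X)"
proof -
  have "mat_subalgebra N (carrier_mat N N)"
    by (rule mat_subalgebraI) auto
  then have "generated_mat_subalgebra N X \<subseteq> carrier_mat N N"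
    using assms by (rule generated_mat_subalgebra_least)
  then show ?thesis
    by (rule mat_subalgebraI)
       (auto simp: generated_mat_subalgebra_def dest: mat_subalgebraD)
qed

text \<open>The eigenvalue is multiplicative and additive in \<open>X\<close>. This reduces statements about a
  generated algebra to its generators.\<close>

lemma mat_subalgebra_common_eigenmatrix:
  assumes M: "M \<in> carrier_mat N N"
  shows "mat_subalgebra N {X \<in> carrier_mat N N. \<exists>c. X * M = c \<cdot>\<^sub>m M \<and> M * X = c \<cdot>\<^sub>m M}"
    (is "mat_subalgebra N ?S")
proof (rule mat_subalgebraI)
  show "1\<^sub>m N \<in> ?S"
    using M by (auto intro!: exI[of _ 1])
next
  fix X Y assume "X \<in> ?S" "Y \<in> ?S"
  then obtain c d where X: "X \<in> carrier_mat N N" "X * M = c \<cdot>\<^sub>m M" "M * X = c \<cdot>\<^sub>m M"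
    and Y: "Y \<in> carrier_mat N N" "Y * M = d \<cdot>\<^sub>m M" "M * Y = d \<cdot>\<^sub>m M" by blast
  have "X * Y * M = (c * d) \<cdot>\<^sub>m M"
    using M X Y by (simp add: assoc_mult_mat[of X N N Y N M N] mult_smult_distrib[of X N N M N]
        smult_smult_mat mult.commute)
  moreover have "M * (X * Y) = (c * d) \<cdot>\<^sub>m M"
    using M X Y by (simp add: assoc_mult_mat[symmetric, of M N N X N Y N] mult_smult_assoc_mat[of M N N Y N]
        smult_smult_mat mult.commute)
  ultimately show "X * Y \<in> ?S" using X(1) Y(1) by auto
  have "(X + Y) * M = (c + d) \<cdot>\<^sub>m M"
    using M X Y by (simp add: add_mult_distrib_mat[of X N N Y M N] add_smult_distrib_right_mat[of M N N])
  moreover have "M * (X + Y) = (c + d) \<cdot>\<^sub>m M"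
    using M X Y by (simp add: mult_add_distrib_mat[of M N N X N Y] add_smult_distrib_right_mat[of M N N])
  ultimately show "X + Y \<in> ?S" using X(1) Y(1) by auto
next
  fix a X assume "X \<in> ?S"
  then obtain c where X: "X \<in> carrier_mat N N" "X * M = c \<cdot>\<^sub>m M" "M * X = c \<cdot>\<^sub>m M" by blast
  then have "(a \<cdot>\<^sub>m X) * M = (a * c) \<cdot>\<^sub>m M" "M * (a \<cdot>\<^sub>m X) = (a * c) \<cdot>\<^sub>m M"
    using M by (simp_all add: smult_smult_mat mult_smult_assoc_mat[of X N N M N]
        mult_smult_distrib[of M N N X N])
  then show "a \<cdot>\<^sub>m X \<in> ?S" using X(1) by auto
qed auto

text \<open>If some nonzero multiple \<open>c M\<close> lies in an ideal \<open>J\<close>, then multiplying by the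
  scalar matrix \<open>b / c\<close>, which belongs to the unital algebra, puts every \<open>b M\<close> in \<open>J\<close>.\<close>

lemma minimal_ideal_line:
  assumes S: "mat_subalgebra N S" and M: "M \<in> S" "M \<noteq> 0\<^sub>m N N"
    and eig: "\<And>X. X \<in> S \<Longrightarrow> \<exists>c. X * M = c \<cdot>\<^sub>m M \<and> M * X = c \<cdot>\<^sub>m M"
  shows "minimal_ideal (range (\<lambda>c. c \<cdot>\<^sub>m M)) ((ring_mat TYPE(complex) N ()) \<lparr>carrier := S\<rparr>)"
    (is "minimal_ideal ?I ?R")
proof -
  interpret A: ring "ring_mat TYPE(complex) N ()" by (rule ring_mat)
  interpret R: ring ?R
    using S by (intro A.subring_is_ring) (simp add: mat_subalgebra_def)
  note SD = mat_subalgebraD[OF S]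
  have Mc: "M \<in> carrier_mat N N" using M SD by blast
  have line: "a \<cdot>\<^sub>m (b \<cdot>\<^sub>m M) \<in> ?I" for a b
    by (simp add: smult_smult_mat)
  have "ideal ?I ?R"
  proof (rule idealI[OF R.ring_axioms])
    show "subgroup ?I (add_monoid ?R)"
    proof (rule R.add.subgroupI)
      fix X assume "X \<in> ?I"
      then obtain c where X: "X = c \<cdot>\<^sub>m M" by blast
      have "\<ominus>\<^bsub>?R\<^esub> X = (- c) \<cdot>\<^sub>m M"
      proof (rule R.minus_equality)
        show "(- c) \<cdot>\<^sub>m M \<oplus>\<^bsub>?R\<^esub> X = \<zero>\<^bsub>?R\<^esub>"
          using Mc X by (intro eq_matI) (auto simp: ring_mat_simps)
      qed (use X SD M in \<open>auto simp: ring_mat_simps\<close>)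
      then show "\<ominus>\<^bsub>?R\<^esub> X \<in> ?I" by blast
    next
      fix X Y assume "X \<in> ?I" "Y \<in> ?I"
      then obtain c d where X: "X = c \<cdot>\<^sub>m M" and Y: "Y = d \<cdot>\<^sub>m M" by blast
      have "X \<oplus>\<^bsub>?R\<^esub> Y = (c + d) \<cdot>\<^sub>m M"
        using X Y Mc by (simp add: ring_mat_simps add_smult_distrib_right_mat[of M N N])
      then show "X \<oplus>\<^bsub>?R\<^esub> Y \<in> ?I" by blast
    qed (use SD M in auto)
  next
    fix A X assume "A \<in> ?I" "X \<in> carrier ?R"
    then obtain a c where A: "A = a \<cdot>\<^sub>m M" and X: "X \<in> carrier_mat N N"
      and c: "X * M = c \<cdot>\<^sub>m M" "M * X = c \<cdot>\<^sub>m M"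
      using eig SD(1) by (auto, blast)
    show "X \<otimes>\<^bsub>?R\<^esub> A \<in> ?I" "A \<otimes>\<^bsub>?R\<^esub> X \<in> ?I"
      using A c X Mc line by (simp_all add: ring_mat_simps mult_smult_distrib[of _ N N _ N]
          mult_smult_assoc_mat[of _ N N _ N])
  qed
  moreover have "?I \<noteq> {\<zero>\<^bsub>?R\<^esub>}"
  proof -
    have "M \<in> ?I" by (rule range_eqI[of _ _ 1]) (use Mc in auto)
    then show ?thesis using M(2) by (auto simp: ring_mat_simps)
  qed
  moreover have "J = {\<zero>\<^bsub>?R\<^esub>} \<or> J = ?I" if J: "ideal J ?R" "J \<subseteq> ?I" for J
  proof (rule disjCI)
    assume "J \<noteq> ?I"
    have zero: "\<zero>\<^bsub>?R\<^esub> \<in> J"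
      using additive_subgroup.zero_closed[OF ideal.axioms(1)[OF J(1)]] .
    have "X = \<zero>\<^bsub>?R\<^esub>" if X: "X \<in> J" for X
    proof (rule ccontr)
      assume X0: "X \<noteq> \<zero>\<^bsub>?R\<^esub>"
      obtain c where c: "X = c \<cdot>\<^sub>m M" using X J(2) by blast
      have "c \<noteq> 0" using X0 c Mc by (auto simp: ring_mat_simps)
      have "b \<cdot>\<^sub>m M \<in> J" for b
      proof -
        have "(b / c) \<cdot>\<^sub>m 1\<^sub>m N \<in> carrier ?R" using SD by simp
        from ideal.I_l_closed[OF J(1) X this]
        show ?thesis using Mc \<open>c \<noteq> 0\<close>
          by (simp add: c ring_mat_simps smult_smult_mat mult_smult_assoc_mat[of _ N N _ N])
      qed
      then show False using J(2) \<open>J \<noteq> ?I\<close> by blast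
    qed
    then show "J = {\<zero>\<^bsub>?R\<^esub>}" using zero by blast
  qed
  ultimately show ?thesis unfolding minimal_ideal_def by blast
qed

lemma identity_of_ideal_line:
  assumes M: "M \<in> carrier_mat N N" and idem: "M * M = M"
  shows "identity_of_ideal ((ring_mat TYPE(complex) N ()) \<lparr>carrier := S\<rparr>) (range (\<lambda>c. c \<cdot>\<^sub>m M)) M"
proof -
  have "M \<in> range (\<lambda>c. c \<cdot>\<^sub>m M)"
    by (rule range_eqI[of _ _ 1]) (use M in auto)
  then show ?thesis
    unfolding identity_of_ideal_def using M idem
    by (auto simp: ring_mat_simps mult_smult_distrib[of _ N N _ N] mult_smult_assoc_mat[of _ N N _ N])
qed


section \<open>Matrices indexed by the group\<close>

lemma group_mat_carrier [simp]: "group_mat G \<nu> f \<in> carrier_mat (order G) (order G)"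
  by (simp add: group_mat_def)

lemma group_mat_add: "group_mat G \<nu> f + group_mat G \<nu> g = group_mat G \<nu> (\<lambda>x y. f x y + g x y)"
  by (rule eq_matI) (auto simp: group_mat_def)

lemma group_mat_smult: "c \<cdot>\<^sub>m group_mat G \<nu> f = group_mat G \<nu> (\<lambda>x y. c * f x y)"
  by (rule eq_matI) (auto simp: group_mat_def)

lemma group_mat_mult:
  assumes \<nu>: "bij_betw \<nu> {..<order G} (carrier G)"
  shows "group_mat G \<nu> f * group_mat G \<nu> g = group_mat G \<nu> (\<lambda>x y. \<Sum>z\<in>carrier G. f x z * g z y)"
proof (rule eq_matI)
  fix i j
  assume "i < dim_row (group_mat G \<nu> (\<lambda>x y. \<Sum>z\<in>carrier G. f x z * g z y))"
    and "j < dim_col (group_mat G \<nu> (\<lambda>x y. \<Sum>z\<in>carrier G. f x z * g z y))"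
  then have ij: "i < order G" "j < order G" by (simp_all add: group_mat_def)
  have "(group_mat G \<nu> f * group_mat G \<nu> g) $$ (i, j)
      = (\<Sum>k<order G. f (\<nu> i) (\<nu> k) * g (\<nu> k) (\<nu> j))"
    using ij by (simp add: group_mat_def scalar_prod_def atLeast0LessThan)
  also have "\<dots> = (\<Sum>z\<in>carrier G. f (\<nu> i) z * g z (\<nu> j))"
    by (rule sum.reindex_bij_betw[OF \<nu>])
  finally show "(group_mat G \<nu> f * group_mat G \<nu> g) $$ (i, j)
      = group_mat G \<nu> (\<lambda>x y. \<Sum>z\<in>carrier G. f x z * g z y) $$ (i, j)"
    using ij by (simp add: group_mat_def)
qed (simp_all add: group_mat_def)

lemma group_mat_eq_iff:
  assumes \<nu>: "bij_betw \<nu> {..<order G} (carrier G)"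
  shows "group_mat G \<nu> f = group_mat G \<nu> g \<longleftrightarrow> (\<forall>x\<in>carrier G. \<forall>y\<in>carrier G. f x y = g x y)"
proof -
  have "group_mat G \<nu> f = group_mat G \<nu> g \<longleftrightarrow>
      (\<forall>i\<in>{..<order G}. \<forall>j\<in>{..<order G}. f (\<nu> i) (\<nu> j) = g (\<nu> i) (\<nu> j))"
    (is "_ \<longleftrightarrow> ?R")
  proof
    assume eq: "group_mat G \<nu> f = group_mat G \<nu> g"
    have "f (\<nu> i) (\<nu> j) = g (\<nu> i) (\<nu> j)" if "i < order G" "j < order G" for i j
      using arg_cong[OF eq, of "\<lambda>X. X $$ (i, j)"] that by (simp add: group_mat_def)
    then show ?R by simp
  next
    assume ?R
    then show "group_mat G \<nu> f = group_mat G \<nu> g"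
      by (intro eq_matI) (auto simp: group_mat_def)
  qed
  also have "\<dots> \<longleftrightarrow> (\<forall>x\<in>\<nu> ` {..<order G}. \<forall>y\<in>\<nu> ` {..<order G}. f x y = g x y)"
    by simp
  finally show ?thesis using bij_betw_imp_surj_on[OF \<nu>] by simp
qed

text \<open>As an operator this matrix subtracts from a function on \<open>C\<close> its mean over \<open>C\<close>, and it
  annihilates the functions that vanish on \<open>C\<close>.\<close>

definition centering :: "'a set \<Rightarrow> 'a \<Rightarrow> 'a \<Rightarrow> complex" where
  "centering C x y = (if x \<in> C \<and> y \<in> C then (if x = y then 1 else 0) - 1 / of_nat (card C) else 0)"

lemma centering_sym: "centering C x y = centering C y x"
  by (auto simp: centering_def)

lemma B_mat_eq_centering:
  assumes "card C \<ge> 2"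
  shows "((of_nat (card C) - 1) / of_nat (card C)) \<cdot>\<^sub>m B_mat G \<nu> C = group_mat G \<nu> (centering C)"
proof -
  \<comment> \<open>\<open>d\<close> stands for the entry of the identity matrix.\<close>
  have scale: "(m - 1) / m * (- 1 / (m - 1) * 1 + (1 - - 1 / (m - 1)) * d) = d - 1 / m"
    if "m \<noteq> 0" "m \<noteq> 1" for m d :: complex
  proof -
    have "(m - 1) / m * (- 1 / (m - 1)) = - 1 / m" "(m - 1) / m * (1 - - 1 / (m - 1)) = 1"
      using that by (simp_all add: divide_simps)
    then show ?thesis by (simp only: distrib_left mult_1_right mult.assoc[symmetric]) simp
  qed
  have "of_nat (card C) \<noteq> (0::complex)" "of_nat (card C) \<noteq> (1::complex)"
    using assms by auto
  note scale = scale[OF this]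
  show ?thesis
    unfolding B_mat_def group_mat_smult
  proof (intro arg_cong[of _ _ "group_mat G \<nu>"] ext)
    fix x y
    show "(of_nat (card C) - 1) / of_nat (card C) *
        (if x \<in> C \<and> y \<in> C
         then - 1 / (of_nat (card C) - 1) * 1
              + (1 - - 1 / (of_nat (card C) - 1)) * (if x = y then 1 else 0)
         else 0) = centering C x y"
      by (cases "x \<in> C \<and> y \<in> C")
         (simp_all only: scale centering_def if_True if_False simp_thms mult_zero_right)
  qed
qed

text \<open>Multiplying a row by the centering matrix replaces its entries over \<open>C\<close> by their
  deviations from the mean: zero for a constant row, and for a row
  \<open>\<alpha>, \<dots>, \<alpha>, \<beta>, \<alpha>, \<dots>, \<alpha>\<close> the factor \<open>\<beta> - \<alpha>\<close> times the row of the centering matrix.\<close>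

lemma sum_centering:
  fixes f :: "'a \<Rightarrow> 'a \<Rightarrow> complex"
  assumes A: "finite A" "C \<subseteq> A" and x: "x \<in> A"
    and const: "\<And>y y'. \<lbrakk>x \<notin> C; y \<in> C; y' \<in> C\<rbrakk> \<Longrightarrow> f x y = f x y'"
    and off: "\<And>y. \<lbrakk>x \<in> C; y \<in> C; x \<noteq> y\<rbrakk> \<Longrightarrow> f x y = \<alpha>"
    and diag: "x \<in> C \<Longrightarrow> f x x = \<beta>"
  shows "(\<Sum>z\<in>A. f x z * centering C z y) = (\<beta> - \<alpha>) * centering C x y"
proof (cases "y \<in> C")
  case False
  then show ?thesis by (simp add: centering_def)
next
  case y: True
  have fC: "finite C" using A finite_subset by blast
  have m: "of_nat (card C) \<noteq> (0::complex)" using fC y by auto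
  have "(\<Sum>z\<in>A. f x z * centering C z y) = (\<Sum>z\<in>C. f x z * centering C z y)"
    using A by (intro sum.mono_neutral_right) (auto simp: centering_def)
  also have "\<dots> = (\<Sum>z\<in>C. (if z = y then f x z else 0) - f x z / of_nat (card C))"
    using y by (intro sum.cong) (auto simp: centering_def right_diff_distrib)
  also have "\<dots> = f x y - (\<Sum>z\<in>C. f x z) / of_nat (card C)"
    using fC y by (simp add: sum_subtractf sum_divide_distrib)
  also have "\<dots> = (\<beta> - \<alpha>) * centering C x y"
  proof (cases "x \<in> C")
    case False
    have "(\<Sum>z\<in>C. f x z) = (\<Sum>z\<in>C. f x y)"
      by (intro sum.cong refl const False y)
    then show ?thesis using False m by (simp add: centering_def)
  next
    case True
    have f: "f x z = \<alpha> + (if x = z then \<beta> - \<alpha> else 0)" if "z \<in> C" for z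
      using off diag True that by auto
    have "(\<Sum>z\<in>C. f x z) = (\<Sum>z\<in>C. \<alpha> + (if x = z then \<beta> - \<alpha> else 0))"
      using f by (intro sum.cong) auto
    also have "\<dots> = of_nat (card C) * \<alpha> + (\<beta> - \<alpha>)"
      using fC True by (simp add: sum.distrib)
    finally have "(\<Sum>z\<in>C. f x z) / of_nat (card C) = \<alpha> + (\<beta> - \<alpha>) / of_nat (card C)"
      using m by (simp add: add_divide_distrib)
    moreover have "(\<beta> - \<alpha>) * centering C x y
        = (if x = y then \<beta> - \<alpha> else 0) - (\<beta> - \<alpha>) / of_nat (card C)"
      using True y by (simp add: centering_def right_diff_distrib)
    ultimately show ?thesis
      using f[OF y] by (simp only:) simp
  qed
  finally show ?thesis .
qed

text \<open>The products on the two sides are handled by the same computation, applied to \<open>f\<close> and to its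
  transpose, because the centering matrix is symmetric.\<close>

lemma group_mat_centering_eigen:
  assumes \<nu>: "bij_betw \<nu> {..<order G} (carrier G)" and fin: "finite (carrier G)"
    and C: "C \<subseteq> carrier G"
    and const_right: "\<And>x y y'. \<lbrakk>x \<in> carrier G; x \<notin> C; y \<in> C; y' \<in> C\<rbrakk> \<Longrightarrow> f x y = f x y'"
    and const_left: "\<And>x y y'. \<lbrakk>x \<in> carrier G; x \<notin> C; y \<in> C; y' \<in> C\<rbrakk> \<Longrightarrow> f y x = f y' x"
    and off: "\<And>x y. \<lbrakk>x \<in> C; y \<in> C; x \<noteq> y\<rbrakk> \<Longrightarrow> f x y = \<alpha>"
    and diag: "\<And>x. x \<in> C \<Longrightarrow> f x x = \<beta>"
  shows "group_mat G \<nu> f * group_mat G \<nu> (centering C) = (\<beta> - \<alpha>) \<cdot>\<^sub>m group_mat G \<nu> (centering C)"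
    and "group_mat G \<nu> (centering C) * group_mat G \<nu> f = (\<beta> - \<alpha>) \<cdot>\<^sub>m group_mat G \<nu> (centering C)"
proof -
  show "group_mat G \<nu> f * group_mat G \<nu> (centering C) = (\<beta> - \<alpha>) \<cdot>\<^sub>m group_mat G \<nu> (centering C)"
    unfolding group_mat_mult[OF \<nu>] group_mat_smult group_mat_eq_iff[OF \<nu>]
  proof (intro ballI)
    fix x y assume x: "x \<in> carrier G"
    show "(\<Sum>z\<in>carrier G. f x z * centering C z y) = (\<beta> - \<alpha>) * centering C x y"
      by (rule sum_centering[OF fin C x]; (rule const_right[OF x] off diag; assumption))
  qed
  have "(\<Sum>z\<in>carrier G. centering C x z * f z y) = (\<beta> - \<alpha>) * centering C x y"
    if "x \<in> carrier G" "y \<in> carrier G" for x y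
  proof -
    have "(\<Sum>z\<in>carrier G. centering C x z * f z y) = (\<Sum>z\<in>carrier G. f z y * centering C z x)"
      by (simp add: mult.commute centering_sym[of C x])
    also have "\<dots> = (\<beta> - \<alpha>) * centering C y x"
    proof (rule sum_centering[OF fin C that(2)])
      show "f z y = f z' y" if "y \<notin> C" "z \<in> C" "z' \<in> C" for z z'
        using \<open>y \<in> carrier G\<close> that by (rule const_left)
      show "f z y = \<alpha>" if "y \<in> C" "z \<in> C" "y \<noteq> z" for z
        using that by (intro off) auto
    qed (rule diag)
    finally show ?thesis by (simp add: centering_sym[of C y])
  qed
  then show "group_mat G \<nu> (centering C) * group_mat G \<nu> f = (\<beta> - \<alpha>) \<cdot>\<^sub>m group_mat G \<nu> (centering C)"
    unfolding group_mat_mult[OF \<nu>] group_mat_smult group_mat_eq_iff[OF \<nu>] by blast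
qed

text \<open>The centering matrix itself has the required shape, with
  \<open>\<beta> - \<alpha> = (1 - 1 / |C|) - (- 1 / |C|) = 1\<close>.\<close>

lemma centering_idempotent:
  assumes \<nu>: "bij_betw \<nu> {..<order G} (carrier G)" and fin: "finite (carrier G)"
    and C: "C \<subseteq> carrier G"
  shows "group_mat G \<nu> (centering C) * group_mat G \<nu> (centering C) = group_mat G \<nu> (centering C)"
proof -
  have "group_mat G \<nu> (centering C) * group_mat G \<nu> (centering C)
      = ((1 - 1 / of_nat (card C)) - (- 1 / of_nat (card C))) \<cdot>\<^sub>m group_mat G \<nu> (centering C)"
    by (rule group_mat_centering_eigen[OF \<nu> fin C]) (auto simp: centering_def)
  then show ?thesis by (simp add: group_mat_smult)
qed

lemma dual_idempotent_mat_centering_eigen: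
  assumes \<nu>: "bij_betw \<nu> {..<order G} (carrier G)" and fin: "finite (carrier G)"
    and C: "C \<subseteq> carrier G" and D: "D = C \<or> D \<inter> C = {}"
  shows "\<exists>c. dual_idempotent_mat G \<nu> D * group_mat G \<nu> (centering C) = c \<cdot>\<^sub>m group_mat G \<nu> (centering C)
    \<and> group_mat G \<nu> (centering C) * dual_idempotent_mat G \<nu> D = c \<cdot>\<^sub>m group_mat G \<nu> (centering C)"
proof (intro exI conjI)
  let ?c = "(if D = C then 1 else 0) - 0 :: complex"
  show "dual_idempotent_mat G \<nu> D * group_mat G \<nu> (centering C) = ?c \<cdot>\<^sub>m group_mat G \<nu> (centering C)"
    unfolding dual_idempotent_mat_def
    by (rule group_mat_centering_eigen(1)[OF \<nu> fin C]) (use D in auto)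
  show "group_mat G \<nu> (centering C) * dual_idempotent_mat G \<nu> D = ?c \<cdot>\<^sub>m group_mat G \<nu> (centering C)"
    unfolding dual_idempotent_mat_def
    by (rule group_mat_centering_eigen(2)[OF \<nu> fin C]) (use D in auto)
qed


section \<open>The Terwilliger algebra of a sharp Frobenius group\<close>

context sharp_frobenius_group
begin

lemma adjacency_mat_centering_eigen:
  assumes \<nu>: "bij_betw \<nu> {..<order G} (carrier G)"
    and C: "C \<in> conj_classes G" and D: "D \<in> conj_classes G"
  shows "\<exists>c. adjacency_mat G \<nu> D * group_mat G \<nu> (centering C) = c \<cdot>\<^sub>m group_mat G \<nu> (centering C)
    \<and> group_mat G \<nu> (centering C) * adjacency_mat G \<nu> D = c \<cdot>\<^sub>m group_mat G \<nu> (centering C)"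
proof -
  define f where "f x y = (if y \<otimes> inv x \<in> D then 1 else 0 :: complex)" for x y
  have sub: "C \<subseteq> carrier G" using C by (rule conj_class_subset)
  have f_cong: "f x y = f x' y'"
    if "x \<in> carrier G" "x' \<in> carrier G" "y \<in> carrier G" "y' \<in> carrier G"
      "K #> x = K #> x'" "K #> y = K #> y'" "x = y \<longleftrightarrow> x' = y'" for x x' y y'
    using conj_class_div_cong[OF D that] by (simp add: f_def)
  note coset = conj_class_coset[OF C]
  \<comment> \<open>The case distinction only serves to name the common off-diagonal value, which any pair of
    distinct elements of \<open>C\<close> exhibits.\<close>
  have off: "\<exists>\<alpha>. \<forall>x\<in>C. \<forall>y\<in>C. x \<noteq> y \<longrightarrow> f x y = \<alpha>"
  proof (cases "\<exists>x\<in>C. \<exists>y\<in>C. x \<noteq> y")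
    case True
    then obtain u v where uv: "u \<in> C" "v \<in> C" "u \<noteq> v" by blast
    have "f x y = f u v" if "x \<in> C" "y \<in> C" "x \<noteq> y" for x y
      by (rule f_cong) (use that uv sub coset in blast)+
    then show ?thesis by blast
  qed auto
  then obtain \<alpha> where \<alpha>: "\<And>x y. \<lbrakk>x \<in> C; y \<in> C; x \<noteq> y\<rbrakk> \<Longrightarrow> f x y = \<alpha>" by blast
  have diag: "f x x = (if \<one> \<in> D then 1 else 0)" if "x \<in> C" for x
    using that sub by (auto simp: f_def)
  have right: "f x y = f x y'" if "x \<in> carrier G" "x \<notin> C" "y \<in> C" "y' \<in> C" for x y y'
    by (rule f_cong) (use that sub coset in blast)+
  have left: "f y x = f y' x" if "x \<in> carrier G" "x \<notin> C" "y \<in> C" "y' \<in> C" for x y y'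
    by (rule f_cong) (use that sub coset in blast)+
  have "adjacency_mat G \<nu> D = group_mat G \<nu> f"
    unfolding adjacency_mat_def f_def ..
  then show ?thesis
    using group_mat_centering_eigen[OF \<nu> finite_carrier sub right left \<alpha> diag] by auto
qed

lemma terwilliger_mat_subalgebra:
  "mat_subalgebra (order G) (carrier (terwilliger_algebra G \<nu>))"
  unfolding terwilliger_algebra_def
  by (simp, rule mat_subalgebra_generated) (auto simp: adjacency_mat_def dual_idempotent_mat_def)

lemma generators_in_terwilliger:
  assumes "C \<in> conj_classes G"
  shows "adjacency_mat G \<nu> C \<in> carrier (terwilliger_algebra G \<nu>)"
    and "dual_idempotent_mat G \<nu> C \<in> carrier (terwilliger_algebra G \<nu>)"
  unfolding terwilliger_algebra_def using assms
  by (auto intro!: subsetD[OF generated_mat_subalgebra_incl])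

lemma terwilliger_centering_eigen:
  assumes \<nu>: "bij_betw \<nu> {..<order G} (carrier G)" and C: "C \<in> conj_classes G"
    and X: "X \<in> carrier (terwilliger_algebra G \<nu>)"
  shows "\<exists>c. X * group_mat G \<nu> (centering C) = c \<cdot>\<^sub>m group_mat G \<nu> (centering C)
    \<and> group_mat G \<nu> (centering C) * X = c \<cdot>\<^sub>m group_mat G \<nu> (centering C)"
proof -
  let ?S = "{X \<in> carrier_mat (order G) (order G).
    \<exists>c. X * group_mat G \<nu> (centering C) = c \<cdot>\<^sub>m group_mat G \<nu> (centering C)
      \<and> group_mat G \<nu> (centering C) * X = c \<cdot>\<^sub>m group_mat G \<nu> (centering C)}"
  have "adjacency_mat G \<nu> D \<in> ?S" if D: "D \<in> conj_classes G" for D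
    using adjacency_mat_centering_eigen[OF \<nu> C D] by (simp add: adjacency_mat_def)
  moreover have "dual_idempotent_mat G \<nu> D \<in> ?S" if D: "D \<in> conj_classes G" for D
    using dual_idempotent_mat_centering_eigen[OF \<nu> finite_carrier conj_class_subset[OF C]
        conj_classes_disjoint[OF C D]]
    by (simp add: dual_idempotent_mat_def)
  moreover have "mat_subalgebra (order G) ?S"
    by (rule mat_subalgebra_common_eigenmatrix) simp
  ultimately have "carrier (terwilliger_algebra G \<nu>) \<subseteq> ?S"
    unfolding terwilliger_algebra_def
    by (simp, intro generated_mat_subalgebra_least) auto
  then show ?thesis using X by blast
qed

text \<open>With \<open>E\<close> the dual idempotent of \<open>C\<close> and \<open>A\<close> the adjacency matrix of \<open>K - {1}\<close>, the product
  \<open>E A E\<close> is all ones off the diagonal of the \<open>C, C\<close> block, because two distinct elements of \<open>C\<close>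
  differ by a nontrivial element of \<open>K\<close>. So \<open>E + E A E\<close> is the all-ones block.\<close>

lemma centering_in_terwilliger:
  assumes \<nu>: "bij_betw \<nu> {..<order G} (carrier G)" and C: "C \<in> conj_classes G"
  shows "group_mat G \<nu> (centering C) \<in> carrier (terwilliger_algebra G \<nu>)"
proof -
  let ?E = "dual_idempotent_mat G \<nu> C" and ?A = "adjacency_mat G \<nu> (K - {\<one>})"
  have sub: "C \<subseteq> carrier G" using C by (rule conj_class_subset)
  have adj: "y \<otimes> inv x \<in> K - {\<one>} \<longleftrightarrow> x \<noteq> y" if "x \<in> C" "y \<in> C" for x y
  proof -
    have xy: "x \<in> carrier G" "y \<in> carrier G" using that sub by auto
    have "K #> (y \<otimes> inv x) = K #> (x \<otimes> inv x)"
      using xy conj_class_coset[OF C that] by (intro coset_div_cong) auto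
    then have "K #> (y \<otimes> inv x) = K #> \<one>"
      using xy by simp
    then have "y \<otimes> inv x \<in> K"
      using xy mem_coset_iff[of \<one> "y \<otimes> inv x"] coset_join2[OF one_closed K.is_subgroup K.one_closed]
      by simp
    then show ?thesis using mult_inv_eq_one_iff xy by auto
  qed
  have EAE: "?E * ?A * ?E = group_mat G \<nu> (\<lambda>x y. if x \<in> C \<and> y \<in> C \<and> x \<noteq> y then 1 else 0)"
  proof -
    \<comment> \<open>Multiplying by the diagonal matrix on the left and on the right restricts rows and columns
      to \<open>C\<close>.\<close>
    have inner: "(\<Sum>w\<in>carrier G. (if x = w \<and> w \<in> C then 1 else 0) * g w) = (if x \<in> C then g x else 0)"
      if "x \<in> carrier G" for x and g :: "'a \<Rightarrow> complex"
    proof -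
      have "(\<Sum>w\<in>carrier G. (if x = w \<and> w \<in> C then 1 else 0) * g w)
          = (\<Sum>w\<in>carrier G. if x = w then (if x \<in> C then g x else 0) else 0)"
        by (intro sum.cong) auto
      then show ?thesis using that finite_carrier by simp
    qed
    have outer: "(\<Sum>w\<in>carrier G. g w * (if w = y \<and> y \<in> C then 1 else 0)) = (if y \<in> C then g y else 0)"
      if "y \<in> carrier G" for y and g :: "'a \<Rightarrow> complex"
    proof -
      have "(\<Sum>w\<in>carrier G. g w * (if w = y \<and> y \<in> C then 1 else 0))
          = (\<Sum>w\<in>carrier G. if y = w then (if y \<in> C then g y else 0) else 0)"
        by (intro sum.cong) auto
      then show ?thesis using that finite_carrier by simp
    qed
    show ?thesis
      unfolding dual_idempotent_mat_def adjacency_mat_def group_mat_mult[OF \<nu>] group_mat_eq_iff[OF \<nu>]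
    proof (intro ballI, goal_cases)
      case (1 x y)
      show ?case
        unfolding inner[OF 1(1)] outer[OF 1(2)]
      proof (cases "x \<in> C \<and> y \<in> C")
        case True
        then have "y \<otimes> inv x \<in> K - {\<one>} \<longleftrightarrow> x \<noteq> y" using adj by blast
        then show "(if y \<in> C then if x \<in> C then if y \<otimes> inv x \<in> K - {\<one>} then 1 else 0 else 0 else 0)
            = (if x \<in> C \<and> y \<in> C \<and> x \<noteq> y then 1 else 0 :: complex)"
          using True by (simp only: simp_thms if_True)
      qed auto
    qed
  qed
  have "group_mat G \<nu> (centering C) =
      (1 - 1 / of_nat (card C)) \<cdot>\<^sub>m ?E + (- 1 / of_nat (card C)) \<cdot>\<^sub>m (?E * ?A * ?E)"
    unfolding EAE unfolding dual_idempotent_mat_def group_mat_smult group_mat_add group_mat_eq_iff[OF \<nu>]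
    by (auto simp: centering_def)
  moreover have "?E \<in> carrier (terwilliger_algebra G \<nu>)" "?A \<in> carrier (terwilliger_algebra G \<nu>)"
    using generators_in_terwilliger C kernel_minus_one_conj_class by auto
  ultimately show ?thesis
    using mat_subalgebraD[OF terwilliger_mat_subalgebra] by simp
qed

text \<open>Elements of the primary component are constant on each block.\<close>

lemma centering_notin_primary_component:
  assumes \<nu>: "bij_betw \<nu> {..<order G} (carrier G)" and C: "C \<in> conj_classes G" "card C \<ge> 2"
  shows "group_mat G \<nu> (centering C) \<notin> primary_component G \<nu>"
proof
  assume "group_mat G \<nu> (centering C) \<in> primary_component G \<nu>"
  then obtain a where a: "group_mat G \<nu> (centering C) = group_mat G \<nu> (\<lambda>x y.
      \<Sum>D \<in> conj_classes G. \<Sum>D' \<in> conj_classes G. a D D' * (if x \<in> D \<and> y \<in> D' then 1 else 0))"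
    (is "_ = group_mat G \<nu> ?v")
    by (auto simp: primary_component_def)
  obtain x y where xy: "x \<in> C" "y \<in> C" "x \<noteq> y"
    using C(2) by (auto simp: numeral_2_eq_2 card_le_Suc_iff)
  have sub: "x \<in> carrier G" "y \<in> carrier G" using xy conj_class_subset[OF C(1)] by auto
  have "x \<in> D \<longleftrightarrow> y \<in> D" if "D \<in> conj_classes G" for D
    using conj_classes_disjoint[OF C(1) that] xy by blast
  then have "?v x x = ?v x y"
    by (intro sum.cong refl) simp
  then have "centering C x x = centering C x y"
    using a sub unfolding group_mat_eq_iff[OF \<nu>] by simp
  then show False using xy by (simp add: centering_def)
qed

theorem centering_nonprimary_primitive_idempotent:
  assumes \<nu>: "bij_betw \<nu> {..<order G} (carrier G)" and C: "C \<in> conj_classes G" "card C \<ge> 2"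
  shows "nonprimary_primitive_idempotent G \<nu> (group_mat G \<nu> (centering C))"
proof -
  let ?M = "group_mat G \<nu> (centering C)"
  let ?I = "range (\<lambda>c. c \<cdot>\<^sub>m ?M)"
  have T: "terwilliger_algebra G \<nu>
      = (ring_mat TYPE(complex) (order G) ()) \<lparr>carrier := carrier (terwilliger_algebra G \<nu>)\<rparr>"
    by (simp add: terwilliger_algebra_def)
  have id: "identity_of_ideal (terwilliger_algebra G \<nu>) ?I ?M"
    by (subst T, rule identity_of_ideal_line)
       (simp_all add: centering_idempotent[OF \<nu> finite_carrier conj_class_subset[OF C(1)]])
  then have "?I \<noteq> primary_component G \<nu>"
    using centering_notin_primary_component[OF \<nu> C] by (auto simp: identity_of_ideal_def)
  moreover have "?M \<noteq> 0\<^sub>m (order G) (order G)"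
  proof
    assume "?M = 0\<^sub>m (order G) (order G)"
    then have "?M = group_mat G \<nu> (\<lambda>x y. \<Sum>D \<in> conj_classes G. \<Sum>D' \<in> conj_classes G.
        0 * (if x \<in> D \<and> y \<in> D' then 1 else 0))"
      by (auto simp: group_mat_def)
    then have "?M \<in> primary_component G \<nu>"
      unfolding primary_component_def by (intro CollectI exI[of _ "\<lambda>_ _. 0"]) simp
    then show False using centering_notin_primary_component[OF \<nu> C] by blast
  qed
  then have "minimal_ideal ?I (terwilliger_algebra G \<nu>)"
    by (subst T, intro minimal_ideal_line terwilliger_mat_subalgebra
        centering_in_terwilliger[OF \<nu> C(1)] terwilliger_centering_eigen[OF \<nu> C(1)])
  ultimately show ?thesis
    unfolding nonprimary_primitive_idempotent_def using id by blast
qed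

end

theorem corollary5p1:
  fixes G :: "('a, 'b) monoid_scheme"
    and K H :: "'a set"
    and p n :: nat
    and \<nu> :: "nat \<Rightarrow> 'a"
    and C :: "nat \<Rightarrow> 'a set"
  assumes "group G" and "finite (carrier G)"
    and "prime p" and "n \<ge> 1"
    and "semidirect_product_of G K H"
    and "G\<lparr>carrier := K\<rparr> \<cong> product_group {..<n} (\<lambda>_. integer_mod_group p)"
    and "G\<lparr>carrier := H\<rparr> \<cong> integer_mod_group (p ^ n - 1)"
    and "frobenius_complement G H" and "K = frobenius_kernel G H"
    and "bij_betw \<nu> {..<order G} (carrier G)"
    and "bij_betw C {0..p ^ n - 1} (conj_classes G)" and "C 0 = {\<one>\<^bsub>G\<^esub>}"
  shows "\<forall>i \<in> {1..p ^ n - 1}.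
    nonprimary_primitive_idempotent G \<nu>
      (((of_nat (card (C i)) - 1) / of_nat (card (C i))) \<cdot>\<^sub>m B_mat G \<nu> (C i))"
proof -
  have p2: "p \<ge> 2" using assms(3) by (rule prime_ge_2_nat)
  have pn: "p ^ n \<ge> 2"
    using p2 assms(4) self_le_power[of p n] by linarith
  have "card K = card (carrier (product_group {..<n} (\<lambda>_. integer_mod_group p)))"
    using iso_same_card[OF assms(6)] by simp
  also have "\<dots> = p ^ n"
    using p2 by (simp add: card_PiE carrier_integer_mod_group)
  finally have cardK: "card K = p ^ n" .
  have "card H = card (carrier (integer_mod_group (p ^ n - 1)))"
    using iso_same_card[OF assms(7)] by simp
  also have "\<dots> = p ^ n - 1"
  proof -
    have "card (carrier (integer_mod_group m)) = m" if "m > 0" for m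
      using that by (simp add: carrier_integer_mod_group)
    then show ?thesis using pn by simp
  qed
  finally have cardH: "card H = p ^ n - 1" .
  have comm: "x \<otimes>\<^bsub>G\<^esub> y = y \<otimes>\<^bsub>G\<^esub> x" if "x \<in> H" "y \<in> H" for x y
  proof -
    obtain \<phi> where \<phi>: "\<phi> \<in> hom (G\<lparr>carrier := H\<rparr>) (integer_mod_group (p ^ n - 1))" and inj: "inj_on \<phi> H"
      using assms(7) by (auto simp: is_iso_def iso_iff)
    have "\<phi> (x \<otimes>\<^bsub>G\<^esub> y) = \<phi> (y \<otimes>\<^bsub>G\<^esub> x)"
      using hom_mult[OF \<phi>, of x y] hom_mult[OF \<phi>, of y x] that by (simp add: add.commute)
    moreover have "x \<otimes>\<^bsub>G\<^esub> y \<in> H" "y \<otimes>\<^bsub>G\<^esub> x \<in> H"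
      using that assms(5) by (auto simp: semidirect_product_of_def subgroup.m_closed)
    ultimately show ?thesis using inj by (auto dest: inj_onD)
  qed
  interpret sharp_frobenius_group G K H
    using assms comm cardK cardH pn
    by (intro sharp_frobenius_group.intro sharp_frobenius_group_axioms.intro) auto
  show ?thesis
  proof
    fix i assume i: "i \<in> {1..p ^ n - 1}"
    have Ci: "C i \<in> conj_classes G"
      using bij_betwE[OF assms(11)] i by simp
    have "C i \<noteq> C 0"
      using bij_betw_imp_inj_on[OF assms(11)] i by (auto dest: inj_onD)
    then have "card (C i) \<ge> 2"
      using card_conj_class_ge2[OF Ci] assms(12) by simp
    then show "nonprimary_primitive_idempotent G \<nu>
        (((of_nat (card (C i)) - 1) / of_nat (card (C i))) \<cdot>\<^sub>m B_mat G \<nu> (C i))"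
      using centering_nonprimary_primitive_idempotent[OF assms(10) Ci] B_mat_eq_centering by metis
  qed
qed

end
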